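(* Let $t_0<T<+\infty$ and let $a,b,c,d$ be real-valued continuous functions on $[t_0,T]$. Assume that $a(t)<0$ almost everywhere on $[t_0,T]$, that $\frac{b^2(t)}{a(t)}$ is integrable on $[t_0,T]$, that $$\int_{t_0}^{t}\exp\Big\{\int_{t_0}^{\tau}\Big[c(s)-\frac{b^2(s)}{a(s)}\Big]ds\Big\}d(\tau)\,d\tau\ge0,\qquad t\in[t_0,T],$$ and that the differential inequality $$\eta'+a(t)\eta^3+b(t)\eta^2+c(t)\eta+d(t)\le0$$ has a solution $\eta(t)$ on $[t_0,T]$ such that $\eta(t_0)\le\eta(T)<0$. Then the equation $$y'+a(t)y^3+b(t)y^2+c(t)y+d(t)=0$$ has a nonpositive closed solution on $[t_0,T]$.
   Context: A solution $y(t)$ of the equation, existing on an interval $[t_0,T]$, is called closed on $[t_0,T]$ if $y(t_0)=y(T)$. A solution of a differential equation or inequality on an interval is a real-valued differentiable function satisfying it at every point of the interval (one-sided derivatives at the endpoints). "Integrable" means Lebesgue integrable. In the integral condition, $d(\tau)$ is the value of the coefficient function $d$ and $d\tau$ is the differential. *)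

theory Defs
  imports "HOL-Analysis.Analysis"
begin

text \<open>
  Since the derivative is taken within the compact interval, it is one-sided at the endpoints.
\<close>

definition abel_equation_solution ::
  "(real \<Rightarrow> real) \<Rightarrow> (real \<Rightarrow> real) \<Rightarrow> (real \<Rightarrow> real) \<Rightarrow> (real \<Rightarrow> real) \<Rightarrow> real \<Rightarrow> real \<Rightarrow> (real \<Rightarrow> real) \<Rightarrow> bool"
  where
  "abel_equation_solution a b c d t0 T y \<longleftrightarrow>
     (\<forall>t\<in>{t0..T}. \<exists>y'. (y has_real_derivative y') (at t within {t0..T}) \<and>
        y' + a t * y t ^ 3 + b t * y t ^ 2 + c t * y t + d t = 0)"

definition abel_inequality_solution ::
  "(real \<Rightarrow> real) \<Rightarrow> (real \<Rightarrow> real) \<Rightarrow> (real \<Rightarrow> real) \<Rightarrow> (real \<Rightarrow> real) \<Rightarrow> real \<Rightarrow> real \<Rightarrow> (real \<Rightarrow> real) \<Rightarrow> bool"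
  where
  "abel_inequality_solution a b c d t0 T \<eta> \<longleftrightarrow>
     (\<forall>t\<in>{t0..T}. \<exists>\<eta>'. (\<eta> has_real_derivative \<eta>') (at t within {t0..T}) \<and>
        \<eta>' + a t * \<eta> t ^ 3 + b t * \<eta> t ^ 2 + c t * \<eta> t + d t \<le> 0)"

definition closed_on :: "real \<Rightarrow> real \<Rightarrow> (real \<Rightarrow> real) \<Rightarrow> bool"
  where "closed_on t0 T y \<longleftrightarrow> y t0 = y T"

end

theory Submission imports Defs begin

text \<open>
  The closed solution is a fixed point of the Poincare map \<open>x \<mapsto> y(T)\<close>, where \<open>y\<close> solves the
  equation with \<open>y(t0) = x\<close>. The point is that this map sends the interval from \<open>\<eta>(t0)\<close> to
  \<open>0\<close> continuously into itself, so that the intermediate value theorem applies to \<open>y(T) - x\<close>.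

  The lower bound is the usual comparison principle: \<open>\<eta>\<close> is a subsolution, so a solution that starts
  above \<open>\<eta>\<close> stays above it (\<open>differential_inequality_nonpos\<close>), and \<open>\<eta>(T) \<ge> \<eta>(t0)\<close>.

  The upper bound \<open>y \<le> 0\<close> uses the integral condition, since \<open>0\<close> need not be a supersolution. Read
  the equation as the linear equation \<open>y' + g y + d = 0\<close> with \<open>g = a y\<^sup>2 + b y + c\<close>. Variation of
  constants gives \<open>y \<le> 0\<close> as soon as the integrals of \<open>exp (\<integral>g) d\<close> from \<open>t0\<close> are nonnegative. Now
  \<open>a y\<^sup>2 + b y + b\<^sup>2 / a = a ((y + b / (2 a))\<^sup>2 + 3 (b / (2 a))\<^sup>2) \<le> 0\<close> wherever \<open>a < 0\<close>, so \<open>g\<close>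
  is at most \<open>h = c - b\<^sup>2 / a\<close> almost everywhere and \<open>exp (\<integral>g)\<close> is the hypothesised weight
  \<open>exp (\<integral>h)\<close> times a positive nonincreasing factor. By the second mean value theorem such a factor
  preserves nonnegativity of all integrals from \<open>t0\<close> (\<open>weighted_integral_nonneg\<close>).

  Solutions of a cubic equation may blow up, so the argument is run for the equation with
  \<open>a y\<^sup>2 + b y + c\<close> replaced by \<open>a q\<^sup>2 + b q + c\<close>, where \<open>q\<close> is \<open>y\<close> cut off to \<open>[-M, M]\<close> and
  \<open>M \<ge> \<bar>\<eta>\<bar>\<close>. Its right-hand side is globally Lipschitz in \<open>y\<close>, so solutions exist on all of
  \<open>[t0, T]\<close> (\<open>picard_global_solution\<close>) and depend continuously on their initial value
  (\<open>solutions_lipschitz_in_initial_value\<close>). Cutting off only inside \<open>g\<close> keeps the form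
  \<open>y' + g y + d = 0\<close> with \<open>g \<le> h\<close>, so both bounds hold for the modified equation too; they confine
  the solutions to \<open>[-M, 0]\<close>, where the two equations agree.
\<close>

section \<open>Scalar differential inequalities\<close>

lemma has_real_derivative_nonpos_imp_antimono:
  fixes f :: "real \<Rightarrow> real"
  assumes "a \<le> b"
    and der: "\<And>t. t \<in> {a..b} \<Longrightarrow> (f has_real_derivative f' t) (at t within {a..b})"
    and nonpos: "\<And>t. t \<in> {a<..<b} \<Longrightarrow> f' t \<le> 0"
  shows "f b \<le> f a"
proof (rule DERIV_nonpos_imp_decreasing_open[OF \<open>a \<le> b\<close>])
  show "\<exists>y. (f has_real_derivative y) (at x) \<and> y \<le> 0" if "a < x" "x < b" for x
    using der[of x] nonpos[of x] that at_within_Icc_at[of a x b] by auto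
  show "continuous_on {a..b} f"
    by (rule DERIV_continuous_on[OF der])
qed

text \<open>
  If \<open>w\<close> were positive somewhere, consider the last earlier point \<open>s\<close> with \<open>w s \<le> 0\<close>: after it,
  \<open>exp (- L u) * w u\<close> is nonincreasing, so \<open>w\<close> cannot have become positive. Constraining the
  derivative only where \<open>w > 0\<close> lets a two-sided Lipschitz bound be used for one-sided comparison.
\<close>

lemma differential_inequality_nonpos:
  fixes w :: "real \<Rightarrow> real"
  assumes der: "\<And>t. t \<in> {t0..T} \<Longrightarrow> (w has_real_derivative w' t) (at t within {t0..T})"
    and init: "w t0 \<le> 0"
    and growth: "\<And>t. t \<in> {t0..T} \<Longrightarrow> w t > 0 \<Longrightarrow> w' t \<le> L * w t"
    and t: "t \<in> {t0..T}"
  shows "w t \<le> 0"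
proof (rule ccontr)
  assume "\<not> w t \<le> 0"
  then have pos: "w t > 0" by simp
  have cont: "continuous_on {t0..T} w"
    by (rule DERIV_continuous_on[OF der])
  define S where "S = {s \<in> {t0..t}. w s \<le> 0}"
  have "closed S"
    unfolding S_def using t
    by (intro continuous_on_closed_Collect_le continuous_on_subset[OF cont] continuous_intros) auto
  moreover have "t0 \<in> S" "bdd_above S"
    using init t by (auto simp: S_def intro: bdd_aboveI[of _ t])
  ultimately have "Sup S \<in> S"
    using closed_contains_Sup by blast
  define s where "s = Sup S"
  have s: "t0 \<le> s" "s \<le> t" "w s \<le> 0"
    using \<open>Sup S \<in> S\<close> by (auto simp: S_def s_def)
  have after: "w u > 0" if "u \<in> {s<..<t}" for u
  proof (rule ccontr)
    assume "\<not> w u > 0"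
    then have "u \<in> S" using that s by (auto simp: S_def)
    then have "u \<le> s" unfolding s_def using \<open>bdd_above S\<close> by (rule cSup_upper)
    then show False using that by simp
  qed
  have "exp (- L * t) * w t \<le> exp (- L * s) * w s"
  proof (rule has_real_derivative_nonpos_imp_antimono[OF \<open>s \<le> t\<close>])
    fix u assume u: "u \<in> {s..t}"
    have "(w has_real_derivative w' u) (at u within {s..t})"
      by (rule DERIV_subset[OF der]) (use u s t in auto)
    then show "((\<lambda>u. exp (- L * u) * w u) has_real_derivative
        exp (- L * u) * (w' u - L * w u)) (at u within {s..t})"
      by (auto intro!: derivative_eq_intros simp: algebra_simps)
  next
    fix u assume u: "u \<in> {s<..<t}"
    then show "exp (- L * u) * (w' u - L * w u) \<le> 0"
      using growth[of u] after[OF u] s t by (simp add: mult_nonneg_nonpos)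
  qed
  also have "\<dots> \<le> 0" using s by (simp add: mult_nonneg_nonpos)
  finally show False using pos by (simp add: mult_le_0_iff)
qed

section \<open>Initial value problems with a globally Lipschitz right-hand side\<close>

text \<open>
  Picard iteration on the whole interval at once. Writing \<open>y = E z\<close> with the weight
  \<open>E t = exp (2 L (t - t0))\<close>, the integral operator becomes a contraction in the supremum norm of
  \<open>z\<close> with factor \<open>1/2\<close>, because the integral of \<open>L E\<close> from \<open>t0\<close> to \<open>t\<close> is at most \<open>E t / 2\<close>.
\<close>

lemma picard_global_solution:
  fixes f :: "real \<Rightarrow> real \<Rightarrow> real"
  assumes "t0 \<le> T" "L > 0"
    and cont: "continuous_on ({t0..T} \<times> UNIV) (\<lambda>(t, x). f t x)"
    and lip: "\<And>t x y. t \<in> {t0..T} \<Longrightarrow> \<bar>f t x - f t y\<bar> \<le> L * \<bar>x - y\<bar>"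
  obtains y where "y t0 = x0"
    and "\<And>t. t \<in> {t0..T} \<Longrightarrow> (y has_real_derivative f t (y t)) (at t within {t0..T})"
proof -
  define E where "E t = exp (2 * L * (t - t0))" for t
  have E_pos: "E t > 0" for t by (simp add: E_def)
  have E_cont: "continuous_on A E" for A
    unfolding E_def by (intro continuous_intros)
  have comp_cont: "continuous_on {t0..T} (\<lambda>s. f s (u s))" if "continuous_on {t0..T} u" for u
    by (rule continuous_on_compose2[OF cont, of _ "\<lambda>s. (s, u s)", simplified])
       (auto intro!: continuous_intros that)
  define P where "P u t = x0 + integral {t0..t} (\<lambda>s. f s (u s))" for u t
  have P_der: "(P u has_real_derivative f t (u t)) (at t within {t0..T})"
    if "continuous_on {t0..T} u" "t \<in> {t0..T}" for u t
    unfolding P_def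
    using integral_has_real_derivative[OF comp_cont[OF that(1)] that(2)]
    by (auto intro!: derivative_eq_intros)
  have P_cont: "continuous_on {t0..T} (P u)" if "continuous_on {t0..T} u" for u
    by (rule DERIV_continuous_on[OF P_der[OF that]])
  \<comment> \<open>The complete space is that of bounded continuous functions on the whole line, so functions on
     the interval are extended by their boundary values.\<close>
  define \<Phi> where
    "\<Phi> z = Bcontfun (ext_cont (\<lambda>t. P (\<lambda>s. E s * apply_bcontfun z s) t / E t) t0 T)" for z
  have z_cont: "continuous_on {t0..T} (\<lambda>s. E s * apply_bcontfun z s)" for z
    by (intro continuous_intros E_cont continuous_on_apply_bcontfun)
  have q_cont: "continuous_on {t0..T} (\<lambda>t. P (\<lambda>s. E s * apply_bcontfun z s) t / E t)" for z
    by (intro continuous_intros P_cont z_cont E_cont) (use E_pos less_irrefl in metis)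
  have \<Phi>: "apply_bcontfun (\<Phi> z) t = P (\<lambda>s. E s * apply_bcontfun z s) (clamp t0 T t) / E (clamp t0 T t)"
    for z t
  proof -
    have "ext_cont (\<lambda>t. P (\<lambda>s. E s * apply_bcontfun z s) t / E t) t0 T \<in> bcontfun"
      using q_cont[of z] \<open>t0 \<le> T\<close>
      by (auto intro!: continuous_on_ext_cont simp: bcontfun_def)
        (auto simp: ext_cont_def intro!: clamp_bounded compact_imp_bounded[OF compact_continuous_image])
    then show ?thesis
      by (simp add: \<Phi>_def Bcontfun_inverse ext_cont_def)
  qed
  have contraction: "dist (\<Phi> z) (\<Phi> v) \<le> 1/2 * dist z v" for z v
  proof (rule dist_bound)
    fix t0'
    define t where "t = clamp t0 T t0'"
    have t: "t \<in> {t0..T}"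
      using clamp_in_interval[of t0 T t0'] \<open>t0 \<le> T\<close> by (auto simp: t_def)
    let ?z = "\<lambda>s. E s * apply_bcontfun z s" and ?v = "\<lambda>s. E s * apply_bcontfun v s"
    have sub: "{t0..t} \<subseteq> {t0..T}" using t by auto
    have fz: "(\<lambda>s. f s (?z s)) integrable_on {t0..t}" and fv: "(\<lambda>s. f s (?v s)) integrable_on {t0..t}"
      by (intro integrable_continuous_real continuous_on_subset[OF comp_cont sub] z_cont)+
    have "((\<lambda>s. E s * (L * dist z v)) has_integral
            E t * (dist z v / 2) - E t0 * (dist z v / 2)) {t0..t}"
      by (rule fundamental_theorem_of_calculus)
         (use t \<open>L > 0\<close> in \<open>auto simp: E_def simp flip: has_real_derivative_iff_has_vector_derivative
            intro!: derivative_eq_intros\<close>)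
    then have I: "(\<lambda>s. E s * (L * dist z v)) integrable_on {t0..t}"
      "integral {t0..t} (\<lambda>s. E s * (L * dist z v)) \<le> E t * (dist z v / 2)"
      using E_pos[of t0] by (auto simp del: integral_mult_left integral_mult_right
          simp: has_integral_integrable dest: integral_unique)
    have "norm (integral {t0..t} (\<lambda>s. f s (?z s) - f s (?v s)))
        \<le> integral {t0..t} (\<lambda>s. E s * (L * dist z v))"
    proof (rule integral_norm_bound_integral)
      fix s assume "s \<in> {t0..t}"
      then have "\<bar>f s (?z s) - f s (?v s)\<bar> \<le> L * \<bar>?z s - ?v s\<bar>" using lip sub by blast
      also have "\<dots> = E s * (L * dist (apply_bcontfun z s) (apply_bcontfun v s))"
        using E_pos[of s] by (simp add: dist_real_def abs_mult flip: right_diff_distrib)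
      also have "\<dots> \<le> E s * (L * dist z v)"
        using E_pos[of s] \<open>L > 0\<close> by (intro mult_left_mono dist_bounded) auto
      finally show "norm (f s (?z s) - f s (?v s)) \<le> E s * (L * dist z v)" by simp
    qed (use I fz fv in \<open>auto intro: integrable_diff\<close>)
    then have "\<bar>P ?z t - P ?v t\<bar> \<le> E t * (dist z v / 2)"
      using I(2) by (simp add: P_def integral_diff[OF fz fv])
    then show "dist (apply_bcontfun (\<Phi> z) t0') (apply_bcontfun (\<Phi> v) t0') \<le> 1/2 * dist z v"
      unfolding \<Phi> t_def[symmetric] dist_real_def
      using E_pos[of t] by (simp add: abs_divide field_simps flip: diff_divide_distrib)
  qed
  obtain z where z: "\<Phi> z = z"
    using banach_fix_type[of "1/2" \<Phi>] contraction by auto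
  define y where "y = P (\<lambda>s. E s * apply_bcontfun z s)"
  have y: "y t = E t * apply_bcontfun z t" if "t \<in> {t0..T}" for t
    using \<Phi>[of z t] that E_pos[of t] clamp_cancel_cbox[of t t0 T] by (simp add: y_def z field_simps)
  show ?thesis
  proof
    show "y t0 = x0" by (simp add: y_def P_def)
    show "(y has_real_derivative f t (y t)) (at t within {t0..T})" if "t \<in> {t0..T}" for t
      using P_der[OF z_cont that, of z] y[OF that] by (simp add: y_def)
  qed
qed

text \<open>
  Gronwall's estimate; squaring the difference of the two solutions avoids differentiating an
  absolute value.
\<close>

lemma solutions_lipschitz_in_initial_value:
  fixes f :: "real \<Rightarrow> real \<Rightarrow> real"
  assumes "t0 \<le> T"
    and lip: "\<And>t x y. t \<in> {t0..T} \<Longrightarrow> \<bar>f t x - f t y\<bar> \<le> L * \<bar>x - y\<bar>"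
    and y: "\<And>t. t \<in> {t0..T} \<Longrightarrow> (y has_real_derivative f t (y t)) (at t within {t0..T})"
    and z: "\<And>t. t \<in> {t0..T} \<Longrightarrow> (z has_real_derivative f t (z t)) (at t within {t0..T})"
  shows "\<bar>y T - z T\<bar> \<le> exp (L * (T - t0)) * \<bar>y t0 - z t0\<bar>"
proof -
  define D where "D t = (exp (- L * (t - t0)) * (y t - z t))\<^sup>2" for t
  have "D T \<le> D t0"
  proof (rule has_real_derivative_nonpos_imp_antimono[OF \<open>t0 \<le> T\<close>])
    fix t assume t: "t \<in> {t0..T}"
    show "(D has_real_derivative
        2 * (exp (- L * (t - t0)))\<^sup>2 * ((y t - z t) * (f t (y t) - f t (z t)) - L * (y t - z t)\<^sup>2))
        (at t within {t0..T})"
      unfolding D_def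
      by (rule derivative_eq_intros y[OF t] z[OF t] refl)+ (simp add: power2_eq_square algebra_simps)
  next
    fix t assume t: "t \<in> {t0<..<T}"
    have "(y t - z t) * (f t (y t) - f t (z t)) \<le> \<bar>y t - z t\<bar> * \<bar>f t (y t) - f t (z t)\<bar>"
      by (metis abs_ge_self abs_mult)
    also have "\<dots> \<le> \<bar>y t - z t\<bar> * (L * \<bar>y t - z t\<bar>)"
      using lip[of t] t by (intro mult_left_mono) auto
    also have "\<dots> = L * (y t - z t)\<^sup>2"
      by (simp add: power2_eq_square algebra_simps flip: abs_mult)
    finally show "2 * (exp (- L * (t - t0)))\<^sup>2 *
        ((y t - z t) * (f t (y t) - f t (z t)) - L * (y t - z t)\<^sup>2) \<le> 0"
      by (simp add: mult_nonneg_nonpos)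
  qed
  then have "exp (- L * (T - t0)) * \<bar>y T - z T\<bar> \<le> \<bar>y t0 - z t0\<bar>"
    unfolding D_def by (simp add: abs_le_square_iff[symmetric] abs_mult)
  then have "exp (L * (T - t0)) * (exp (- L * (T - t0)) * \<bar>y T - z T\<bar>) \<le> exp (L * (T - t0)) * \<bar>y t0 - z t0\<bar>"
    by (intro mult_left_mono) auto
  then show ?thesis
    by (simp flip: mult.assoc exp_add)
qed

section \<open>Sign of solutions of linear equations\<close>

text \<open>
  The second mean value theorem writes the weighted integral as
  \<open>(w a - w b) * F c + w b * F b\<close> for some \<open>c\<close>, where \<open>F\<close> is the indefinite integral of \<open>f\<close>.
  Unlike integration by parts, this asks for no regularity of \<open>w\<close> beyond monotonicity.
\<close>

lemma weighted_integral_nonneg: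
  fixes f w :: "real \<Rightarrow> real"
  assumes "a \<le> b" and f: "f integrable_on {a..b}"
    and F: "\<And>t. t \<in> {a..b} \<Longrightarrow> 0 \<le> integral {a..t} f"
    and antimono: "\<And>x y. a \<le> x \<Longrightarrow> x \<le> y \<Longrightarrow> y \<le> b \<Longrightarrow> w y \<le> w x"
    and "0 \<le> w b"
  shows "0 \<le> integral {a..b} (\<lambda>x. w x * f x)"
proof -
  obtain c where c: "c \<in> {a..b}"
    and eq: "integral {a..b} (\<lambda>x. - w x * f x) = - w a * integral {a..c} f + - w b * integral {c..b} f"
    by (rule second_mean_value_theorem[OF f \<open>a \<le> b\<close>, of "\<lambda>x. - w x"]) (use antimono in auto)
  have "integral {c..b} f = integral {a..b} f - integral {a..c} f"
    using Henstock_Kurzweil_Integration.integral_combine[OF _ _ f, of c] c by auto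
  then have "integral {a..b} (\<lambda>x. w x * f x) = (w a - w b) * integral {a..c} f + w b * integral {a..b} f"
    using eq by (simp add: left_diff_distrib right_diff_distrib)
  also have "\<dots> \<ge> 0"
    using antimono[of a b] F[of c] F[of b] c \<open>a \<le> b\<close> \<open>0 \<le> w b\<close> by simp
  finally show ?thesis .
qed

text \<open>
  The quotient of the two integrating factors, \<open>exp (\<integral>g - \<integral>h)\<close>, is positive and nonincreasing,
  so it is an admissible weight.
\<close>

lemma integrating_factor_integral_nonneg:
  fixes g h d :: "real \<Rightarrow> real"
  assumes "t0 \<le> T"
    and g: "set_integrable lebesgue {t0..T} g" and h: "set_integrable lebesgue {t0..T} h"
    and d: "continuous_on {t0..T} d"
    and le: "AE t\<in>{t0..T} in lebesgue. g t \<le> h t"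
    and nonneg: "\<And>t. t \<in> {t0..T} \<Longrightarrow>
      0 \<le> integral {t0..t} (\<lambda>\<tau>. exp (integral {t0..\<tau>} h) * d \<tau>)"
    and t: "t \<in> {t0..T}"
  shows "0 \<le> integral {t0..t} (\<lambda>\<tau>. exp (integral {t0..\<tau>} g) * d \<tau>)"
proof -
  note gi = set_lebesgue_integral_eq_integral(1)[OF g] and hi = set_lebesgue_integral_eq_integral(1)[OF h]
  have increment_le: "integral {x..y} g \<le> integral {x..y} h" if "t0 \<le> x" "y \<le> T" for x y
  proof -
    have sub: "{x..y} \<subseteq> {t0..T}" using that by auto
    have gs: "set_integrable lebesgue {x..y} g" and hs: "set_integrable lebesgue {x..y} h"
      using set_integrable_subset[OF g _ sub] set_integrable_subset[OF h _ sub] by auto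
    have "AE t\<in>{x..y} in lebesgue. g t \<le> h t"
      using le by (rule eventually_mono) (use sub in auto)
    from set_integral_mono_AE[OF gs hs this] show ?thesis
      by (simp add: set_lebesgue_integral_eq_integral gs hs)
  qed
  have split: "integral {t0..y} k = integral {t0..x} k + integral {x..y} k"
    if "t0 \<le> x" "x \<le> y" "y \<le> T" "k integrable_on {t0..T}" for x y and k :: "real \<Rightarrow> real"
    using Henstock_Kurzweil_Integration.integral_combine[of t0 x y k] that
      integrable_subinterval_real[OF that(4), of t0 y] by auto
  let ?w = "\<lambda>\<tau>. exp (integral {t0..\<tau>} g - integral {t0..\<tau>} h)"
  let ?f = "\<lambda>\<tau>. exp (integral {t0..\<tau>} h) * d \<tau>"
  have "0 \<le> integral {t0..t} (\<lambda>\<tau>. ?w \<tau> * ?f \<tau>)"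
  proof (rule weighted_integral_nonneg)
    show "?f integrable_on {t0..t}"
      by (intro integrable_continuous_real continuous_intros continuous_on_subset[OF d]
          continuous_on_subset[OF indefinite_integral_continuous_1[OF hi]]) (use t in auto)
    show "?w y \<le> ?w x" if "t0 \<le> x" "x \<le> y" "y \<le> t" for x y
      using split[of x y g] split[of x y h] increment_le[of x y] gi hi that t by simp
  qed (use t nonneg in auto)
  also have "(\<lambda>\<tau>. ?w \<tau> * ?f \<tau>) = (\<lambda>\<tau>. exp (integral {t0..\<tau>} g) * d \<tau>)"
    by (simp add: exp_diff)
  finally show ?thesis .
qed

text \<open>
  Variation of constants: \<open>exp (\<integral>g) * y\<close> plus the integral of \<open>exp (\<integral>g) * d\<close> is constant
  along solutions.
\<close>

lemma linear_equation_solution_nonpos: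
  fixes y g d :: "real \<Rightarrow> real"
  assumes g: "continuous_on {t0..T} g" and d: "continuous_on {t0..T} d"
    and y: "\<And>t. t \<in> {t0..T} \<Longrightarrow> (y has_real_derivative - (g t * y t + d t)) (at t within {t0..T})"
    and "y t0 \<le> 0"
    and nonneg: "\<And>t. t \<in> {t0..T} \<Longrightarrow> 0 \<le> integral {t0..t} (\<lambda>\<tau>. exp (integral {t0..\<tau>} g) * d \<tau>)"
    and t: "t \<in> {t0..T}"
  shows "y t \<le> 0"
proof -
  let ?e = "\<lambda>\<tau>. exp (integral {t0..\<tau>} g)"
  have sub: "{t0..t} \<subseteq> {t0..T}" using t by auto
  have gt: "continuous_on {t0..t} g" and dt: "continuous_on {t0..t} d"
    using g d continuous_on_subset sub by blast+
  have ed: "continuous_on {t0..t} (\<lambda>\<tau>. ?e \<tau> * d \<tau>)"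
    by (intro continuous_intros dt indefinite_integral_continuous_1 integrable_continuous_real gt)
  define V where "V s = ?e s * y s + integral {t0..s} (\<lambda>\<tau>. ?e \<tau> * d \<tau>)" for s
  have "V t \<le> V t0"
  proof (rule has_real_derivative_nonpos_imp_antimono[where f = V and f' = "\<lambda>_. 0"])
    show "(V has_real_derivative 0) (at s within {t0..t})" if s: "s \<in> {t0..t}" for s
    proof -
      have "s \<in> {t0..T}" using sub s by auto
      have e: "(?e has_real_derivative ?e s * g s) (at s within {t0..t})"
        by (rule derivative_eq_intros integral_has_real_derivative[OF gt s] refl)+
      show ?thesis
        unfolding V_def
        using DERIV_add[OF DERIV_mult[OF e DERIV_subset[OF y[OF \<open>s \<in> {t0..T}\<close>] sub]]
            integral_has_real_derivative[OF ed s]]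
        by (simp add: algebra_simps)
    qed
  qed (use t in auto)
  then have "?e t * y t \<le> 0"
    using nonneg[OF t] \<open>y t0 \<le> 0\<close> by (simp add: V_def)
  then show ?thesis by (simp add: mult_le_0_iff)
qed

section \<open>The truncated equation\<close>

definition cutoff :: "real \<Rightarrow> real \<Rightarrow> real"
  where "cutoff M x = max (- M) (min M x)"

lemma cutoff_eq: "\<bar>x\<bar> \<le> M \<Longrightarrow> cutoff M x = x"
  by (auto simp: cutoff_def)

lemma continuous_on_cutoff [continuous_intros]:
  "continuous_on S f \<Longrightarrow> continuous_on S (\<lambda>x. cutoff M (f x))"
  unfolding cutoff_def by (intro continuous_intros)

text \<open>
  Split \<open>x\<close> into its cutoff \<open>p\<close> and the excess \<open>x - p\<close>. The distance of two points is the sum of the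
  distances of these parts, so it suffices to bound the change of \<open>p ^ (n + 1)\<close> and of
  \<open>p ^ n * (x - p)\<close> separately. In the latter, an excess is nonzero only where \<open>p = \<plusminus> M\<close>, which
  makes the term piecewise linear with slope at most \<open>M ^ n\<close>.
\<close>

lemma cutoff_power_mult_lipschitz:
  assumes "M \<ge> 0"
  shows "\<bar>cutoff M x ^ n * x - cutoff M y ^ n * y\<bar> \<le> (real n + 1) * M ^ n * \<bar>x - y\<bar>"
proof -
  define excess where "excess z = z - cutoff M z" for z
  have bound: "\<bar>cutoff M z\<bar> \<le> M" for z
    using assms by (auto simp: cutoff_def)
  have sum_dist: "\<bar>x - y\<bar> = \<bar>cutoff M x - cutoff M y\<bar> + \<bar>excess x - excess y\<bar>"
    using assms by (auto simp: cutoff_def excess_def max_def min_def)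
  let ?p = "cutoff M x" and ?q = "cutoff M y"
  have "\<bar>?p ^ n * x - ?q ^ n * y\<bar> \<le> \<bar>?p ^ Suc n - ?q ^ Suc n\<bar> + \<bar>?p ^ n * excess x - ?q ^ n * excess y\<bar>"
    by (simp add: excess_def algebra_simps)
  moreover have "\<bar>?p ^ Suc n - ?q ^ Suc n\<bar> \<le> (real n + 1) * M ^ n * \<bar>?p - ?q\<bar>"
  proof -
    have "\<bar>\<Sum>i<Suc n. ?q ^ (Suc n - Suc i) * ?p ^ i\<bar> \<le> (\<Sum>i<Suc n. M ^ n)"
    proof (rule order.trans[OF sum_abs sum_mono])
      fix i assume "i \<in> {..<Suc n}"
      then have "M ^ n = M ^ (n - i) * M ^ i" by (simp flip: power_add)
      moreover have "\<bar>?q\<bar> ^ (n - i) * \<bar>?p\<bar> ^ i \<le> M ^ (n - i) * M ^ i"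
        using bound assms by (intro mult_mono power_mono) auto
      ultimately show "\<bar>?q ^ (Suc n - Suc i) * ?p ^ i\<bar> \<le> M ^ n"
        by (simp add: abs_mult power_abs)
    qed
    also have "\<dots> = (real n + 1) * M ^ n" by simp
    finally show ?thesis
      unfolding power_diff_sumr2 abs_mult
      using mult_left_mono[OF _ abs_ge_zero[of "?p - ?q"]] by (metis mult.commute)
  qed
  moreover have "\<bar>?p ^ n * excess x - ?q ^ n * excess y\<bar> \<le> M ^ n * \<bar>excess x - excess y\<bar>"
  proof (cases "excess x * excess y > 0")
    case True
    \<comment> \<open>Both points lie beyond the same end of the cutoff interval.\<close>
    then have "?p = ?q" "\<bar>?p\<bar> = M"
      using assms by (auto simp: cutoff_def excess_def max_def min_def zero_less_mult_iff split: if_splits)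
    then show ?thesis
      by (simp add: abs_mult power_abs flip: right_diff_distrib)
  next
    case False
    then have opposite: "\<bar>excess x - excess y\<bar> = \<bar>excess x\<bar> + \<bar>excess y\<bar>"
      by (auto simp: zero_less_mult_iff)
    have "\<bar>cutoff M z ^ n * e\<bar> \<le> M ^ n * \<bar>e\<bar>" for z e
      unfolding abs_mult power_abs using bound by (intro mult_right_mono power_mono) auto
    from add_mono[OF this[of x "excess x"] this[of y "excess y"]] show ?thesis
      unfolding opposite distrib_left using abs_triangle_ineq4 order.trans by blast
  qed
  moreover have "M ^ n * \<bar>excess x - excess y\<bar> \<le> (real n + 1) * M ^ n * \<bar>excess x - excess y\<bar>"
    using assms by (intro mult_right_mono) (auto simp: algebra_simps)
  ultimately show ?thesis
    unfolding sum_dist distrib_left by linarith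
qed

lemma truncated_abel_lipschitz:
  fixes a b c d :: real
  assumes "M \<ge> 0" "\<bar>a\<bar> \<le> B" "\<bar>b\<bar> \<le> B" "\<bar>c\<bar> \<le> B"
  shows "\<bar>- ((a * cutoff M x ^ 2 + b * cutoff M x + c) * x + d) -
          - ((a * cutoff M y ^ 2 + b * cutoff M y + c) * y + d)\<bar> \<le> B * (3 * M\<^sup>2 + 2 * M + 1) * \<bar>x - y\<bar>"
proof -
  let ?D = "\<lambda>n. cutoff M x ^ n * x - cutoff M y ^ n * y"
  have "\<bar>a * ?D 2 + b * ?D 1 + c * ?D 0\<bar> \<le> \<bar>a * ?D 2\<bar> + \<bar>b * ?D 1\<bar> + \<bar>c * ?D 0\<bar>"
    by linarith
  also have "\<dots> \<le> B * (3 * M\<^sup>2 * \<bar>x - y\<bar>) + B * (2 * M * \<bar>x - y\<bar>) + B * \<bar>x - y\<bar>"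
    using cutoff_power_mult_lipschitz[OF \<open>M \<ge> 0\<close>, of x 2 y] cutoff_power_mult_lipschitz[OF \<open>M \<ge> 0\<close>, of x 1 y] assms
    unfolding abs_mult by (intro add_mono mult_mono) auto
  finally show ?thesis
    by (simp add: algebra_simps abs_minus_commute)
qed

theorem theorem5p4:
  fixes t0 T :: real and a b c d :: "real \<Rightarrow> real"
  assumes "t0 < T"
    and "continuous_on {t0..T} a" and "continuous_on {t0..T} b"
    and "continuous_on {t0..T} c" and "continuous_on {t0..T} d"
    and "AE t\<in>{t0..T} in lebesgue. a t < 0"
    and "set_integrable lebesgue {t0..T} (\<lambda>t. (b t)\<^sup>2 / a t)"
    and "\<And>t. t \<in> {t0..T} \<Longrightarrow>
      0 \<le> (LINT \<tau>:{t0..t}|lebesgue.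
             exp (LINT s:{t0..\<tau>}|lebesgue. c s - (b s)\<^sup>2 / a s) * d \<tau>)"
    and "\<exists>\<eta>. abel_inequality_solution a b c d t0 T \<eta> \<and> \<eta> t0 \<le> \<eta> T \<and> \<eta> T < 0"
  shows "\<exists>y. abel_equation_solution a b c d t0 T y \<and> closed_on t0 T y \<and>
             (\<forall>t\<in>{t0..T}. y t \<le> 0)"
proof -
  note [continuous_intros] = assms(2-5)
  define h where "h s = c s - (b s)\<^sup>2 / a s" for s
  have h: "set_integrable lebesgue {t0..T} h"
    unfolding h_def by (intro set_integral_diff assms absolutely_integrable_continuous_real)
  have h_nonneg: "0 \<le> integral {t0..t} (\<lambda>\<tau>. exp (integral {t0..\<tau>} h) * d \<tau>)" if t: "t \<in> {t0..T}" for t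
  proof -
    have int_h: "(LINT s:{t0..\<tau>}|lebesgue. h s) = integral {t0..\<tau>} h" if "\<tau> \<in> {t0..t}" for \<tau>
      by (intro set_lebesgue_integral_eq_integral set_integrable_subset[OF h]) (use t that in auto)
    have "continuous_on {t0..t} (\<lambda>\<tau>. exp (integral {t0..\<tau>} h) * d \<tau>)"
      by (intro continuous_intros continuous_on_subset[OF \<open>continuous_on {t0..T} d\<close>]
          continuous_on_subset[OF indefinite_integral_continuous_1[OF
            set_lebesgue_integral_eq_integral(1)[OF h]]]) (use t in auto)
    note integrable = absolutely_integrable_continuous_real[OF this]
    have "(LINT \<tau>:{t0..t}|lebesgue. exp (LINT s:{t0..\<tau>}|lebesgue. h s) * d \<tau>)
        = (LINT \<tau>:{t0..t}|lebesgue. exp (integral {t0..\<tau>} h) * d \<tau>)"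
      by (rule set_lebesgue_integral_cong) (auto simp: int_h)
    also have "\<dots> = integral {t0..t} (\<lambda>\<tau>. exp (integral {t0..\<tau>} h) * d \<tau>)"
      by (rule set_lebesgue_integral_eq_integral(2)[OF integrable])
    finally show ?thesis using assms(8)[OF t] by (simp add: h_def)
  qed

  obtain \<eta> where \<eta>_sol: "abel_inequality_solution a b c d t0 T \<eta>" and \<eta>_ends: "\<eta> t0 \<le> \<eta> T" "\<eta> T < 0"
    using assms(9) by blast
  obtain \<eta>' where \<eta>': "\<And>t. t \<in> {t0..T} \<Longrightarrow> (\<eta> has_real_derivative \<eta>' t) (at t within {t0..T})"
    and \<eta>_le: "\<And>t. t \<in> {t0..T} \<Longrightarrow> \<eta>' t + a t * \<eta> t ^ 3 + b t * \<eta> t ^ 2 + c t * \<eta> t + d t \<le> 0"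
    using \<eta>_sol unfolding abel_inequality_solution_def by metis
  have \<eta>_cont: "continuous_on {t0..T} \<eta>"
    by (rule DERIV_continuous_on[OF \<eta>'])
  have bounded: "\<exists>B>0. \<forall>t\<in>{t0..T}. \<bar>k t\<bar> \<le> B" if "continuous_on {t0..T} k" for k :: "real \<Rightarrow> real"
    using compact_imp_bounded[OF compact_continuous_image[OF that]] by (auto simp: bounded_pos)
  obtain M where "M > 0" and M: "\<And>t. t \<in> {t0..T} \<Longrightarrow> \<bar>\<eta> t\<bar> \<le> M"
    using bounded[OF \<eta>_cont] by blast
  have "continuous_on {t0..T} (\<lambda>t. \<bar>a t\<bar> + \<bar>b t\<bar> + \<bar>c t\<bar>)"
    by (intro continuous_intros)
  from bounded[OF this] obtain B where "B > 0"
    and B: "\<And>t. t \<in> {t0..T} \<Longrightarrow> \<bar>a t\<bar> \<le> B \<and> \<bar>b t\<bar> \<le> B \<and> \<bar>c t\<bar> \<le> B" by fastforce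

  let ?q = "cutoff M"
  define f where "f t x = - ((a t * ?q x ^ 2 + b t * ?q x + c t) * x + d t)" for t x
  define L where "L = B * (3 * M\<^sup>2 + 2 * M + 1)"
  have "L > 0" unfolding L_def using \<open>B > 0\<close> \<open>M > 0\<close> by (intro mult_pos_pos add_nonneg_pos) auto
  have lip: "\<bar>f t x - f t y\<bar> \<le> L * \<bar>x - y\<bar>" if "t \<in> {t0..T}" for t x y
    unfolding f_def L_def using truncated_abel_lipschitz B[OF that] \<open>M > 0\<close> by simp
  have f_cont: "continuous_on ({t0..T} \<times> UNIV) (\<lambda>(t, x). f t x)"
    unfolding f_def case_prod_beta
    by (intro continuous_intros assms(2-5)[THEN continuous_on_compose2]) auto
  have "\<exists>y. y t0 = x \<and> (\<forall>t\<in>{t0..T}. (y has_real_derivative f t (y t)) (at t within {t0..T}))" for x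
    by (rule picard_global_solution[OF less_imp_le[OF \<open>t0 < T\<close>] \<open>L > 0\<close> f_cont lip]) auto
  then obtain Y where Y_init: "\<And>x. Y x t0 = x"
    and Y: "\<And>x t. t \<in> {t0..T} \<Longrightarrow> (Y x has_real_derivative f t (Y x t)) (at t within {t0..T})"
    by metis

  \<comment> \<open>The cutoff does not affect \<open>\<eta>\<close>, so \<open>\<eta>\<close> is a subsolution of the truncated equation as well.\<close>
  have Y_ge: "\<eta> t \<le> Y x t" if x: "\<eta> t0 \<le> x" and t: "t \<in> {t0..T}" for x t
  proof -
    have "\<eta> t - Y x t \<le> 0"
    proof (rule differential_inequality_nonpos[where w = "\<lambda>t. \<eta> t - Y x t"])
      show "((\<lambda>t. \<eta> t - Y x t) has_real_derivative \<eta>' s - f s (Y x s)) (at s within {t0..T})"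
        if "s \<in> {t0..T}" for s
        by (intro DERIV_diff \<eta>' Y that)
      show "\<eta>' s - f s (Y x s) \<le> L * (\<eta> s - Y x s)"
        if s: "s \<in> {t0..T}" and pos: "\<eta> s - Y x s > 0" for s
      proof -
        have "\<eta>' s \<le> f s (\<eta> s)"
          using \<eta>_le[OF s] M[OF s]
          by (simp add: f_def cutoff_eq power2_eq_square power3_eq_cube algebra_simps)
        then show ?thesis using lip[OF s, of "\<eta> s" "Y x s"] pos by linarith
      qed
    qed (use x t Y_init in auto)
    then show ?thesis by simp
  qed

  have Y_le: "Y x t \<le> 0" if x: "x \<le> 0" and t: "t \<in> {t0..T}" for x t
  proof -
    define g where "g t = a t * ?q (Y x t) ^ 2 + b t * ?q (Y x t) + c t" for t
    have g: "continuous_on {t0..T} g"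
      unfolding g_def by (intro continuous_intros DERIV_continuous_on[OF Y])
    have "AE t\<in>{t0..T} in lebesgue. g t \<le> h t"
      using assms(6)
    proof (rule eventually_mono, intro impI)
      fix t assume "t \<in> {t0..T} \<longrightarrow> a t < 0" "t \<in> {t0..T}"
      then have neg: "a t < 0" by simp
      let ?u = "?q (Y x t)"
      have "a t * ?u\<^sup>2 + b t * ?u + (b t)\<^sup>2 / a t = a t * ((?u + b t / (2 * a t))\<^sup>2 + 3 * (b t / (2 * a t))\<^sup>2)"
        using neg by (simp add: field_simps power2_eq_square)
      also have "\<dots> \<le> 0"
        using neg by (intro mult_nonpos_nonneg) auto
      finally show "g t \<le> h t" by (simp add: g_def h_def)
    qed
    then have "0 \<le> integral {t0..t} (\<lambda>\<tau>. exp (integral {t0..\<tau>} g) * d \<tau>)" if "t \<in> {t0..T}" for t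
      using integrating_factor_integral_nonneg[OF _ _ h assms(5) _ h_nonneg that]
        absolutely_integrable_continuous_real[OF g] \<open>t0 < T\<close> by simp
    then show ?thesis
      using linear_equation_solution_nonpos[OF g assms(5), of "Y x"] Y x t Y_init
      by (simp add: f_def g_def)
  qed

  have "continuous_on {\<eta> t0..0} (\<lambda>x. Y x T - x)"
  proof -
    have "(exp (L * (T - t0)))-lipschitz_on {\<eta> t0..0} (\<lambda>x. Y x T)"
    proof (rule lipschitz_onI)
      fix x x'
      show "dist (Y x T) (Y x' T) \<le> exp (L * (T - t0)) * dist x x'"
        using solutions_lipschitz_in_initial_value[OF _ lip Y Y] \<open>t0 < T\<close>
        by (simp add: dist_real_def Y_init)
    qed simp
    then show ?thesis by (intro continuous_intros lipschitz_on_continuous_on)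
  qed
  moreover have "Y (\<eta> t0) T - \<eta> t0 \<ge> 0" "Y 0 T - 0 \<le> 0" "\<eta> t0 \<le> 0"
    using Y_ge[of "\<eta> t0" T] Y_le[of 0 T] \<eta>_ends \<open>t0 < T\<close> by auto
  ultimately obtain x where x: "\<eta> t0 \<le> x" "x \<le> 0" "Y x T - x = 0"
    using IVT2'[of "\<lambda>x. Y x T - x" 0 0 "\<eta> t0"] by blast

  have "abel_equation_solution a b c d t0 T (Y x)"
    unfolding abel_equation_solution_def
  proof (intro ballI exI conjI)
    fix t assume t: "t \<in> {t0..T}"
    show "(Y x has_real_derivative f t (Y x t)) (at t within {t0..T})" by (rule Y[OF t])
    have "\<bar>Y x t\<bar> \<le> M"
      using Y_ge[OF x(1) t] Y_le[OF x(2) t] M[OF t] by linarith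
    then show "f t (Y x t) + a t * Y x t ^ 3 + b t * (Y x t)\<^sup>2 + c t * Y x t + d t = 0"
      by (simp add: f_def cutoff_eq power2_eq_square power3_eq_cube algebra_simps)
  qed
  moreover have "closed_on t0 T (Y x)"
    using x(3) by (simp add: closed_on_def Y_init)
  ultimately show ?thesis using Y_le[OF x(2)] by blast
qed

end
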